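(* For a Möbius automorphism $\phi:\mathbb{D}\to\mathbb{D}$ and a bounded operator $\mathbf{T}$ on $L^2(\mathbb{D})$, write $\mathbf{T}_\phi:=\mathbf{U}_\phi\mathbf{T}\bar{\mathbf{U}}_\phi^*$, which has the same norm as $\mathbf{T}$. Then, with $\mathcal{Q}[\mathbf{T}](z,w):=zw\,\mathcal{P}[\mathbf{T}](z,w)$ and $\oslash\mathcal{Q}[\mathbf{T}](z):=z^2\,\mathcal{P}[\mathbf{T}](z,z)$, we have the identity \[ \oslash\mathcal{Q}[\mathbf{T}_\phi](z)=\oslash\mathcal{Q}[\mathbf{T}]\circ\phi(z)-\mathcal{Q}[\mathbf{T}](\phi(z),\phi(0))-\mathcal{Q}[\mathbf{T}](\phi(0),\phi(z))+\oslash\mathcal{Q}[\mathbf{T}](\phi(0)),\qquad z\in\mathbb{D}. \]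
   Context: $\mathbb{D}=\{z\in\mathbb{C}:|z|<1\}$; $dA=\frac1\pi\,dx\,dy$ is normalized area measure; $L^2(\mathbb{D})$ is the complex $L^2$ space with respect to $dA$, with $\langle f,g\rangle_{\mathbb{D}}=\int_{\mathbb{D}}f\,\bar g\,dA$. Operators are $\mathbb{C}$-linear and $^*$ denotes the adjoint. For $z\in\mathbb{D}$, $\mathrm{s}_z(\zeta)=\frac{1}{1-\bar z\zeta}$, and $\bar{\mathrm{s}}_z$ is the function $\zeta\mapsto\overline{\mathrm{s}_z(\zeta)}$. For a bounded operator $\mathbf{T}$ on $L^2(\mathbb{D})$, its Dirichlet operator symbol is $\mathcal{P}[\mathbf{T}](z,w)=\langle\mathbf{T}\,\bar{\mathrm{s}}_z,\mathrm{s}_w\rangle_{\mathbb{D}}$, $z,w\in\mathbb{D}$. For a Möbius automorphism $\phi$ of $\mathbb{D}$, the associated unitary transformations $\mathbf{U}_\phi$, $\bar{\mathbf{U}}_\phi$ of $L^2(\mathbb{D})$ are $\mathbf{U}_\phi f(z)=\phi'(z)\,f(\phi(z))$ and $\bar{\mathbf{U}}_\phi f(z)=\overline{\phi'(z)}\,f(\phi(z))$. *)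

theory Defs
  imports "HOL-Complex_Analysis.Complex_Analysis"
begin

definition disc_area :: "complex measure" where
  "disc_area = density (restrict_space lborel (ball 0 1)) (\<lambda>_. ennreal (1 / pi))"

definition sq_integrable :: "(complex \<Rightarrow> complex) \<Rightarrow> bool" where
  "sq_integrable f \<longleftrightarrow>
     f \<in> borel_measurable disc_area \<and> integrable disc_area (\<lambda>z. (cmod (f z))\<^sup>2)"

definition l2_eq :: "(complex \<Rightarrow> complex) \<Rightarrow> (complex \<Rightarrow> complex) \<Rightarrow> bool" where
  "l2_eq f g \<longleftrightarrow> sq_integrable f \<and> sq_integrable g \<and> (AE z in disc_area. f z = g z)"

lemma l2_eqI:
  "sq_integrable f \<Longrightarrow> sq_integrable g \<Longrightarrow> (AE z in disc_area. f z = g z) \<Longrightarrow> l2_eq f g"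
  by (simp add: l2_eq_def)

lemma l2_eqD:
  assumes "l2_eq f g"
  shows "sq_integrable f" "sq_integrable g" "AE z in disc_area. f z = g z"
  using assms by (simp_all add: l2_eq_def)

lemma sq_integrable_zero: "sq_integrable (\<lambda>z. 0)"
  by (simp add: sq_integrable_def)

lemma sq_integrable_cmult: "sq_integrable f \<Longrightarrow> sq_integrable (\<lambda>z. c * f z)"
  unfolding sq_integrable_def norm_mult power_mult_distrib
  by (auto intro: borel_measurable_times)

lemma sq_integrable_add:
  assumes "sq_integrable f" "sq_integrable g"
  shows "sq_integrable (\<lambda>z. f z + g z)"
proof -
  have [measurable]: "f \<in> borel_measurable disc_area" "g \<in> borel_measurable disc_area"
    using assms by (auto simp: sq_integrable_def)
  have "(cmod (f z + g z))\<^sup>2 \<le> 2 * (cmod (f z))\<^sup>2 + 2 * (cmod (g z))\<^sup>2" for z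
  proof -
    have "(cmod (f z + g z))\<^sup>2 \<le> (cmod (f z) + cmod (g z))\<^sup>2"
      by (intro power_mono norm_triangle_ineq) auto
    also have "\<dots> \<le> 2 * (cmod (f z))\<^sup>2 + 2 * (cmod (g z))\<^sup>2"
      using sum_squares_bound[of "cmod (f z)" "cmod (g z)"] by (simp add: power2_sum)
    finally show ?thesis .
  qed
  then have bound: "norm ((cmod (f z + g z))\<^sup>2) \<le> norm (2 * (cmod (f z))\<^sup>2 + 2 * (cmod (g z))\<^sup>2)" for z
    by simp
  have "integrable disc_area (\<lambda>z. (cmod (f z + g z))\<^sup>2)"
  proof (rule Bochner_Integration.integrable_bound)
    show "integrable disc_area (\<lambda>z. 2 * (cmod (f z))\<^sup>2 + 2 * (cmod (g z))\<^sup>2)"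
      using assms by (simp add: sq_integrable_def)
    show "(\<lambda>z. (cmod (f z + g z))\<^sup>2) \<in> borel_measurable disc_area"
      by measurable
    show "AE z in disc_area. norm ((cmod (f z + g z))\<^sup>2)
        \<le> norm (2 * (cmod (f z))\<^sup>2 + 2 * (cmod (g z))\<^sup>2)"
      by (intro AE_I2 bound)
  qed
  moreover have "(\<lambda>z. f z + g z) \<in> borel_measurable disc_area"
    by measurable
  ultimately show ?thesis
    by (simp only: sq_integrable_def)
qed

lemma sq_integrable_uminus: "sq_integrable f \<Longrightarrow> sq_integrable (\<lambda>z. - f z)"
  using sq_integrable_cmult[of f "-1"] by simp

lemma sq_integrable_diff:
  "sq_integrable f \<Longrightarrow> sq_integrable g \<Longrightarrow> sq_integrable (\<lambda>z. f z - g z)"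
  using sq_integrable_add[OF _ sq_integrable_uminus, of f g] by simp

lemma measurable_mult_cnj:
  assumes "sq_integrable f" "sq_integrable g"
  shows "(\<lambda>z. f z * cnj (g z)) \<in> borel_measurable disc_area"
proof -
  have [measurable]: "cnj \<in> borel_measurable borel"
    by (intro borel_measurable_continuous_onI continuous_intros)
  have [measurable]: "f \<in> borel_measurable disc_area" "g \<in> borel_measurable disc_area"
    using assms by (auto simp: sq_integrable_def)
  show ?thesis by measurable
qed

lemma integrable_mult_cnj:
  assumes "sq_integrable f" "sq_integrable g"
  shows "integrable disc_area (\<lambda>z. f z * cnj (g z))"
proof (rule Bochner_Integration.integrable_bound)
  show "integrable disc_area (\<lambda>z. (cmod (f z))\<^sup>2 + (cmod (g z))\<^sup>2)"
    using assms by (simp add: sq_integrable_def)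
  show "(\<lambda>z. f z * cnj (g z)) \<in> borel_measurable disc_area"
    using assms by (rule measurable_mult_cnj)
  have "norm (f z * cnj (g z)) \<le> norm ((cmod (f z))\<^sup>2 + (cmod (g z))\<^sup>2)" for z
  proof -
    have "norm (f z * cnj (g z)) = cmod (f z) * cmod (g z)"
      by (simp add: norm_mult)
    also have "\<dots> \<le> (cmod (f z))\<^sup>2 + (cmod (g z))\<^sup>2"
      using sum_squares_bound[of "cmod (f z)" "cmod (g z)"]
        mult_nonneg_nonneg[OF norm_ge_zero[of "f z"] norm_ge_zero[of "g z"]] by linarith
    finally show ?thesis by simp
  qed
  then show "AE z in disc_area. norm (f z * cnj (g z))
      \<le> norm ((cmod (f z))\<^sup>2 + (cmod (g z))\<^sup>2)"
    by (intro AE_I2)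
qed

quotient_type l2_disc = "complex \<Rightarrow> complex" / partial: l2_eq
  morphisms rep_l2 to_l2
proof (rule part_equivpI)
  show "\<exists>f. l2_eq f f"
    using sq_integrable_zero by (auto simp: l2_eq_def)
  show "symp l2_eq"
    by (auto simp: symp_def l2_eq_def eq_commute)
  show "transp l2_eq"
  proof (rule transpI)
    fix f g h assume fg: "l2_eq f g" and gh: "l2_eq g h"
    have "AE z in disc_area. f z = h z"
      using l2_eqD(3)[OF fg] l2_eqD(3)[OF gh] by eventually_elim simp
    then show "l2_eq f h"
      using l2_eqD[OF fg] l2_eqD[OF gh] by (intro l2_eqI)
  qed
qed

lift_definition scaleC :: "complex \<Rightarrow> l2_disc \<Rightarrow> l2_disc"  (infixr "*\<^sub>C" 75)
  is "\<lambda>c f z. c * f z"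
proof -
  fix c f g assume h: "l2_eq f g"
  have "AE z in disc_area. c * f z = c * g z"
    using l2_eqD(3)[OF h] by eventually_elim simp
  then show "l2_eq (\<lambda>z. c * f z) (\<lambda>z. c * g z)"
    using l2_eqD[OF h] by (intro l2_eqI sq_integrable_cmult)
qed

lift_definition cinner :: "l2_disc \<Rightarrow> l2_disc \<Rightarrow> complex"
  is "\<lambda>f g. \<integral>z. f z * cnj (g z) \<partial>disc_area"
proof -
  fix f f' g g' assume h: "l2_eq f f'" "l2_eq g g'"
  have "AE z in disc_area. f z * cnj (g z) = f' z * cnj (g' z)"
    using l2_eqD(3)[OF h(1)] l2_eqD(3)[OF h(2)] by eventually_elim simp
  then show "(\<integral>z. f z * cnj (g z) \<partial>disc_area) = (\<integral>z. f' z * cnj (g' z) \<partial>disc_area)"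
    using l2_eqD[OF h(1)] l2_eqD[OF h(2)] by (intro integral_cong_AE measurable_mult_cnj)
qed

text \<open>The real inner product is the real part of the complex one; it induces the usual
  norm, so that the library notions \<^const>\<open>bounded_linear\<close> and \<^const>\<open>onorm\<close> apply.\<close>

instantiation l2_disc :: real_inner
begin

lift_definition zero_l2_disc :: l2_disc is "\<lambda>z. 0"
  by (simp add: l2_eq_def sq_integrable_zero)

lift_definition plus_l2_disc :: "l2_disc \<Rightarrow> l2_disc \<Rightarrow> l2_disc" is "\<lambda>f g z. f z + g z"
proof -
  fix f f' g g' assume h: "l2_eq f f'" "l2_eq g g'"
  have "AE z in disc_area. f z + g z = f' z + g' z"
    using l2_eqD(3)[OF h(1)] l2_eqD(3)[OF h(2)] by eventually_elim simp
  then show "l2_eq (\<lambda>z. f z + g z) (\<lambda>z. f' z + g' z)"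
    using l2_eqD[OF h(1)] l2_eqD[OF h(2)] by (intro l2_eqI sq_integrable_add)
qed

lift_definition minus_l2_disc :: "l2_disc \<Rightarrow> l2_disc \<Rightarrow> l2_disc" is "\<lambda>f g z. f z - g z"
proof -
  fix f f' g g' assume h: "l2_eq f f'" "l2_eq g g'"
  have "AE z in disc_area. f z - g z = f' z - g' z"
    using l2_eqD(3)[OF h(1)] l2_eqD(3)[OF h(2)] by eventually_elim simp
  then show "l2_eq (\<lambda>z. f z - g z) (\<lambda>z. f' z - g' z)"
    using l2_eqD[OF h(1)] l2_eqD[OF h(2)] by (intro l2_eqI sq_integrable_diff)
qed

lift_definition uminus_l2_disc :: "l2_disc \<Rightarrow> l2_disc" is "\<lambda>f z. - f z"
proof -
  fix f g assume h: "l2_eq f g"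
  have "AE z in disc_area. - f z = - g z"
    using l2_eqD(3)[OF h] by eventually_elim simp
  then show "l2_eq (\<lambda>z. - f z) (\<lambda>z. - g z)"
    using l2_eqD[OF h] by (intro l2_eqI sq_integrable_uminus)
qed

definition scaleR_l2_disc :: "real \<Rightarrow> l2_disc \<Rightarrow> l2_disc" where
  "scaleR_l2_disc r F = complex_of_real r *\<^sub>C F"

definition inner_l2_disc :: "l2_disc \<Rightarrow> l2_disc \<Rightarrow> real" where
  "inner_l2_disc F G = Re (cinner F G)"

definition norm_l2_disc :: "l2_disc \<Rightarrow> real" where
  "norm_l2_disc F = sqrt (inner F F)"

definition dist_l2_disc :: "l2_disc \<Rightarrow> l2_disc \<Rightarrow> real" where
  "dist_l2_disc F G = norm (F - G)"

definition sgn_l2_disc :: "l2_disc \<Rightarrow> l2_disc" where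
  "sgn_l2_disc F = inverse (norm F) *\<^sub>R F"

definition uniformity_l2_disc :: "(l2_disc \<times> l2_disc) filter" where
  "uniformity_l2_disc = (INF e\<in>{0<..}. principal {(F, G). dist F G < e})"

definition open_l2_disc :: "l2_disc set \<Rightarrow> bool" where
  "open_l2_disc S \<longleftrightarrow> (\<forall>F\<in>S. \<forall>\<^sub>F (F', G) in uniformity. F' = F \<longrightarrow> G \<in> S)"

instance
proof
  fix F G H :: l2_disc and r s :: real and S :: "l2_disc set"
  show "F + G + H = F + (G + H)"
    by transfer (auto simp: l2_eq_def add.assoc intro!: sq_integrable_add)
  show "F + G = G + F"
    by transfer (auto simp: l2_eq_def add.commute intro!: sq_integrable_add)
  show "0 + F = F"
    by transfer (auto simp: l2_eq_def)
  show "- F + F = 0"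
    by transfer (auto simp: l2_eq_def sq_integrable_zero)
  show "F - G = F + - G"
    by transfer (auto simp: l2_eq_def intro!: sq_integrable_diff)
  show "r *\<^sub>R (F + G) = r *\<^sub>R F + r *\<^sub>R G"
    unfolding scaleR_l2_disc_def
    by transfer (auto simp: l2_eq_def distrib_left intro!: sq_integrable_add sq_integrable_cmult)
  show "(r + s) *\<^sub>R F = r *\<^sub>R F + s *\<^sub>R F"
    unfolding scaleR_l2_disc_def
    by transfer (auto simp: l2_eq_def distrib_right intro!: sq_integrable_add sq_integrable_cmult)
  show "r *\<^sub>R s *\<^sub>R F = (r * s) *\<^sub>R F"
    unfolding scaleR_l2_disc_def
    by transfer (auto simp: l2_eq_def mult.assoc intro!: sq_integrable_cmult)
  show "1 *\<^sub>R F = F"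
    unfolding scaleR_l2_disc_def by transfer (auto simp: l2_eq_def)
  show "dist F G = norm (F - G)"
    by (rule dist_l2_disc_def)
  show "sgn F = inverse (norm F) *\<^sub>R F"
    by (rule sgn_l2_disc_def)
  show "uniformity = (INF e\<in>{0<..}. principal {(F, G :: l2_disc). dist F G < e})"
    by (rule uniformity_l2_disc_def)
  show "open S \<longleftrightarrow> (\<forall>F\<in>S. \<forall>\<^sub>F (F', G) in uniformity. F' = F \<longrightarrow> G \<in> S)"
    by (rule open_l2_disc_def)
  show "norm F = sqrt (inner F F)"
    by (rule norm_l2_disc_def)
  show "inner F G = inner G F"
    unfolding inner_l2_disc_def
  proof transfer
    fix f g
    have "(\<integral>z. g z * cnj (f z) \<partial>disc_area) = cnj (\<integral>z. f z * cnj (g z) \<partial>disc_area)"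
      by (subst Bochner_Integration.integral_cnj[symmetric]) (simp add: mult.commute)
    then show "Re (\<integral>z. f z * cnj (g z) \<partial>disc_area) = Re (\<integral>z. g z * cnj (f z) \<partial>disc_area)"
      by simp
  qed
  show "inner (F + G) H = inner F H + inner G H"
    unfolding inner_l2_disc_def
    by transfer (simp add: l2_eq_def distrib_right integrable_mult_cnj)
  show "inner (r *\<^sub>R F) G = r * inner F G"
    unfolding inner_l2_disc_def scaleR_l2_disc_def
    by transfer (simp add: l2_eq_def mult.assoc)
  have *: "(\<integral>z. f z * cnj (f z) \<partial>disc_area) = of_real (\<integral>z. (cmod (f z))\<^sup>2 \<partial>disc_area)" for f
    by (subst integral_complex_of_real[symmetric]) (simp only: complex_norm_square)
  show "0 \<le> inner F F"
    unfolding inner_l2_disc_def by transfer (simp add: *)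
  show "inner F F = 0 \<longleftrightarrow> F = 0"
    unfolding inner_l2_disc_def
  proof transfer
    fix f assume "l2_eq f f"
    then have f: "sq_integrable f" by (simp add: l2_eq_def)
    have "Re (\<integral>z. f z * cnj (f z) \<partial>disc_area) = 0 \<longleftrightarrow> (AE z in disc_area. (cmod (f z))\<^sup>2 = 0)"
      using f unfolding *
      by (simp del: power_eq_0_iff zero_eq_power2 add: sq_integrable_def integral_nonneg_eq_0_iff_AE)
    then show "Re (\<integral>z. f z * cnj (f z) \<partial>disc_area) = 0 \<longleftrightarrow> l2_eq f (\<lambda>z. 0)"
      using f by (simp add: l2_eq_def sq_integrable_zero)
  qed
qed

end

definition bounded_op :: "(l2_disc \<Rightarrow> l2_disc) \<Rightarrow> bool" where
  "bounded_op T \<longleftrightarrow> bounded_linear T \<and> (\<forall>c F. T (c *\<^sub>C F) = c *\<^sub>C T F)"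

definition op_adjoint :: "(l2_disc \<Rightarrow> l2_disc) \<Rightarrow> l2_disc \<Rightarrow> l2_disc" where
  "op_adjoint T = (THE S. \<forall>F G. cinner (T F) G = cinner F (S G))"

definition szego :: "complex \<Rightarrow> complex \<Rightarrow> complex" where
  "szego z \<zeta> = 1 / (1 - cnj z * \<zeta>)"

definition dirichlet_symbol :: "(l2_disc \<Rightarrow> l2_disc) \<Rightarrow> complex \<Rightarrow> complex \<Rightarrow> complex" where
  "dirichlet_symbol T z w =
     cinner (T (to_l2 (\<lambda>\<zeta>. cnj (szego z \<zeta>)))) (to_l2 (szego w))"

definition Q_symbol :: "(l2_disc \<Rightarrow> l2_disc) \<Rightarrow> complex \<Rightarrow> complex \<Rightarrow> complex" where
  "Q_symbol T z w = z * w * dirichlet_symbol T z w"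

definition Q_diag :: "(l2_disc \<Rightarrow> l2_disc) \<Rightarrow> complex \<Rightarrow> complex" where
  "Q_diag T z = z\<^sup>2 * dirichlet_symbol T z z"

definition moebius_automorphism :: "(complex \<Rightarrow> complex) \<Rightarrow> bool" where
  "moebius_automorphism \<phi> \<longleftrightarrow>
     (\<exists>t a. cmod a < 1 \<and> (\<forall>z\<in>ball 0 1. \<phi> z = Moebius_function t a z))"

text \<open>On a function that is not square integrable \<^const>\<open>to_l2\<close> is unspecified,
  and \<^const>\<open>rep_l2\<close> chooses a representative of an almost-everywhere class. For a
  Moebius automorphism \<open>\<phi>\<close> the classes below do not depend on this choice, since
  \<open>\<phi>\<close> and its inverse preserve null sets. Only the values of \<open>\<phi>\<close> on the
  disc enter.\<close>

definition U_op :: "(complex \<Rightarrow> complex) \<Rightarrow> l2_disc \<Rightarrow> l2_disc" where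
  "U_op \<phi> F = to_l2 (\<lambda>z. deriv \<phi> z * rep_l2 F (\<phi> z))"

definition Ubar_op :: "(complex \<Rightarrow> complex) \<Rightarrow> l2_disc \<Rightarrow> l2_disc" where
  "Ubar_op \<phi> F = to_l2 (\<lambda>z. cnj (deriv \<phi> z) * rep_l2 F (\<phi> z))"

definition transported_op ::
  "(complex \<Rightarrow> complex) \<Rightarrow> (l2_disc \<Rightarrow> l2_disc) \<Rightarrow> l2_disc \<Rightarrow> l2_disc" where
  "transported_op \<phi> T = U_op \<phi> \<circ> T \<circ> op_adjoint (Ubar_op \<phi>)"

end

theory Submission
  imports Defs
begin

text \<open>A Moebius automorphism \<open>\<phi>\<close> with inverse \<open>\<psi>\<close> transports area measure by the density
  \<open>\<bar>\<phi>'\<bar>\<^sup>2\<close>, so the weighted composition operators \<open>U\<^sub>\<phi>\<close> and its conjugate variant are unitary,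
  with adjoints given by \<open>\<psi>\<close>. Hence the symbol of the transported operator pairs \<open>T\<close> between the
  images under \<open>\<psi>\<close> of the Szego kernels. The function \<open>1 - cnj w * \<psi> \<zeta>\<close> is, up to a constant factor,
  the quotient of \<open>1 - cnj (\<phi> w) * \<zeta>\<close> by \<open>1 - cnj (\<phi> 0) * \<zeta>\<close>; its logarithmic derivative in \<open>\<zeta>\<close>
  expresses \<open>cnj w * \<psi>' * (s\<^sub>w \<circ> \<psi>)\<close> as a difference of two Szego kernels, and sesquilinearity
  produces the four terms of the identity.\<close>

subsection \<open>Change of variables for injective holomorphic maps\<close>

text \<open>The determinant form of the change of variables below concerns maps of
  \<open>real^2\<close>; this identification carries it over to \<open>complex\<close>. The two
  measures agree on boxes, since a complex box pulls back to the box with the same real and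
  imaginary bounds.\<close>

lemma lborel_complex_eq_distr:
  "(lborel :: complex measure) = distr lborel borel (\<lambda>x::real^2. Complex (x$1) (x$2))"
proof (rule lborel_eqI)
  let ?c = "\<lambda>x::real^2. Complex (x$1) (x$2)"
  have meas: "?c \<in> borel_measurable borel"
    by (intro borel_measurable_continuous_onI continuous_intros)
  fix l u :: complex
  assume le: "\<And>b. b \<in> Basis \<Longrightarrow> l \<bullet> b \<le> u \<bullet> b"
  have "?c -` box l u = box (vector [Re l, Im l]) (vector [Re u, Im u])"
    by (auto simp: in_box_complex_iff mem_box_cart forall_2)
  moreover have "Re l \<le> Re u" "Im l \<le> Im u"
    using le[of 1] le[of \<i>] by (auto simp: Basis_complex_def)
  moreover have "(\<Prod>b\<in>(Basis :: (real^2) set). (x::real^2) \<bullet> b) = x$1 * x$2" for x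
  proof -
    have B: "(Basis :: (real^2) set) = {axis 1 1, axis 2 1}"
      by (auto simp: Basis_vec_def UNIV_2)
    have "axis 1 1 \<noteq> (axis 2 1 :: real^2)"
      by (simp add: axis_eq_axis)
    then have "(\<Prod>b\<in>{axis 1 1, axis 2 1}. x \<bullet> b) = x$1 * x$2"
      by (simp add: inner_axis)
    then show ?thesis unfolding B .
  qed
  ultimately show "emeasure (distr lborel borel ?c) (box l u) = (\<Prod>b\<in>Basis. (u - l) \<bullet> b)"
    using meas
    by (auto simp: emeasure_distr emeasure_lborel_box_eq Basis_complex_def Basis_vec_def UNIV_2 inner_axis)
qed simp

text \<open>The real derivative of \<open>f\<close> at \<open>z\<close> is multiplication by
  \<open>f' z\<close>; its matrix is a rotation times a dilation, with determinant
  \<open>(cmod (f' z))\<^sup>2\<close>. Boundedness of the image makes its measure finite, so the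
  gauge integral of the determinant can be read as a Lebesgue integral.\<close>

lemma emeasure_holomorphic_image:
  fixes f :: "complex \<Rightarrow> complex"
  assumes S: "S \<in> sets borel" and fS: "f ` S \<in> sets borel" "bounded (f ` S)"
    and der: "\<And>z. z \<in> S \<Longrightarrow> (f has_field_derivative f' z) (at z)"
    and inj: "inj_on f S"
    and f'[measurable]: "f' \<in> borel_measurable (restrict_space borel S)"
  shows "emeasure lborel (f ` S) = (\<integral>\<^sup>+z\<in>S. ennreal ((cmod (f' z))\<^sup>2) \<partial>lborel)"
proof -
  define c where "c = (\<lambda>x::real^2. Complex (x$1) (x$2))"
  define v where "v = (\<lambda>z. vector [Re z, Im z] :: real^2)"
  have cv: "c (v z) = z" and vc: "v (c x) = x" for z x
    by (auto simp: c_def v_def vec_eq_iff forall_2)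
  have bl: "bounded_linear c" "bounded_linear v"
    unfolding linear_conv_bounded_linear[symmetric] c_def v_def
    by (auto intro!: linearI simp: complex_eq_iff vec_eq_iff forall_2)
  have meas: "c \<in> borel_measurable borel"
    using bl(1) by (intro borel_measurable_continuous_onI linear_continuous_on)
  have im: "v ` X = c -` X" for X
    using cv vc by (auto simp: image_iff) (metis vc)
  define g where "g = (\<lambda>x. v (f (c x)))"
  define g' where "g' = (\<lambda>x h. v (f' (c x) * c h))"
  define T where "T = c -` S"
  have g_im: "g ` T = c -` (f ` S)"
    unfolding im[symmetric] g_def T_def using cv by (auto simp: image_iff)
  have T: "T \<in> sets borel"
    using measurable_sets[OF meas S] by (simp add: T_def)
  have det: "\<bar>det (matrix (g' x))\<bar> = (cmod (f' (c x)))\<^sup>2" for x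
    by (simp add: det_2 matrix_def g'_def v_def c_def axis_def cmod_power2)
      (simp add: power2_eq_square)
  \<comment> \<open>The value of the measure in the general equivalence is taken to be the measure
    itself, so the equation on the left is trivial. Measurability and boundedness of the image then
    yield the integral on the right.\<close>
  have "g ` T \<in> lmeasurable \<and> measure lebesgue (g ` T) = measure lebesgue (g ` T)
     \<longleftrightarrow> ((\<lambda>x. \<bar>det (matrix (g' x))\<bar>) has_integral measure lebesgue (g ` T)) T"
  proof (rule has_measure_differentiable_image)
    show "T \<in> sets lebesgue" using T by simp
    show "inj_on g T"
      using inj cv vc by (auto simp: inj_on_def g_def T_def) metis
    fix x assume "x \<in> T"
    then have d: "(f has_derivative (\<lambda>h. f' (c x) * h)) (at (c x))"
      using der[of "c x"] by (simp add: T_def has_field_derivative_def)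
    have dc: "(c has_derivative c) (at x)"
      using bl(1) by (rule bounded_linear_imp_has_derivative)
    have dv: "(v has_derivative v) (at (f (c x)))"
      using bl(2) by (rule bounded_linear_imp_has_derivative)
    have "(g has_derivative g' x) (at x)"
      using diff_chain_at[OF diff_chain_at[OF dc d] ] dv by (auto simp: o_def g_def g'_def)
    then show "(g has_derivative g' x) (at x within T)"
      by (rule has_derivative_at_withinI)
  qed
  moreover have gT: "g ` T \<in> sets borel"
    unfolding g_im using measurable_sets[OF meas fS(1)] by simp
  moreover have "bounded (g ` T)"
    unfolding g_im im[symmetric] using bounded_linear_image[OF fS(2) bl(2)] .
  ultimately have lm: "g ` T \<in> lmeasurable"
    and int: "((\<lambda>x. \<bar>det (matrix (g' x))\<bar>) has_integral measure lebesgue (g ` T)) T"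
    using bounded_set_imp_lmeasurable[of "g ` T"] sets_completionI_sets[of "g ` T" lborel]
    by (auto simp only: sets_lborel)
  have "(\<integral>\<^sup>+x. indicator T x * ennreal (\<bar>det (matrix (g' x))\<bar>) \<partial>lborel) = ennreal (measure lebesgue (g ` T))"
    using nn_integral_has_integral_lebesgue[OF _ int] by (simp add: ennreal_mult' ennreal_indicator)
  also have "\<dots> = emeasure lborel (g ` T)"
    using lm gT by (simp add: fmeasurable_def less_top emeasure_eq_ennreal_measure main_part_sets)
  also have "\<dots> = emeasure lborel (f ` S)"
    unfolding g_im using fS(1) meas by (subst lborel_complex_eq_distr) (simp add: emeasure_distr c_def)
  finally have "emeasure lborel (f ` S) = (\<integral>\<^sup>+x. indicator S (c x) * ennreal ((cmod (f' (c x)))\<^sup>2) \<partial>lborel)"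
    by (simp add: det T_def indicator_def)
  also have "\<dots> = (\<integral>\<^sup>+z. indicator S z * ennreal ((cmod (f' z))\<^sup>2) \<partial>lborel)"
  proof -
    \<comment> \<open>Measurability of \<open>f'\<close> is given on \<open>S\<close> only;
      extending the integrand by zero makes it Borel on the whole plane, as the pushforward along
      \<open>c\<close> requires.\<close>
    have "(\<lambda>z. ennreal ((cmod (f' z))\<^sup>2)) \<in> borel_measurable (restrict_space borel S)"
      by measurable
    then have "(\<lambda>z. indicator S z * ennreal ((cmod (f' z))\<^sup>2)) \<in> borel_measurable borel"
      using S by (subst (asm) borel_measurable_restrict_space_iff_ennreal) (auto simp: mult.commute)
    then show ?thesis
      using meas by (subst lborel_complex_eq_distr) (simp add: nn_integral_distr c_def)
  qed
  finally show ?thesis by (simp add: mult.commute)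
qed

subsection \<open>Disc automorphisms and area measure\<close>

lemma space_disc_area [simp]: "space disc_area = ball 0 1"
  by (simp add: disc_area_def space_restrict_space)

lemma sets_disc_area: "sets disc_area = sets (restrict_space borel (ball 0 1))"
  by (simp add: disc_area_def cong: sets_restrict_space_cong)

lemma borel_measurable_disc_area_iff:
  "f \<in> borel_measurable disc_area \<longleftrightarrow> f \<in> borel_measurable (restrict_space borel (ball 0 1))"
  using measurable_cong_sets[OF sets_disc_area refl] by blast

lemma continuous_on_imp_borel_measurable_disc_area:
  "continuous_on (ball 0 1) f \<Longrightarrow> f \<in> borel_measurable disc_area"
  unfolding borel_measurable_disc_area_iff by (rule borel_measurable_continuous_on_restrict)

lemma emeasure_disc_area:
  assumes "A \<in> sets borel" "A \<subseteq> ball 0 1"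
  shows "emeasure disc_area A = ennreal (1 / pi) * emeasure lborel A"
  using assms unfolding disc_area_def
  by (subst emeasure_density_const) (auto simp: sets_restrict_space_iff emeasure_restrict_space)

lemma nn_integral_disc_area:
  assumes "f \<in> borel_measurable disc_area"
  shows "(\<integral>\<^sup>+z. f z \<partial>disc_area) = ennreal (1 / pi) * (\<integral>\<^sup>+z\<in>ball 0 1. f z \<partial>lborel)"
proof -
  have "f \<in> borel_measurable (restrict_space lborel (ball 0 1))"
    using assms by (simp add: disc_area_def)
  then show ?thesis
    unfolding disc_area_def
    by (simp add: nn_integral_density nn_integral_cmult nn_integral_restrict_space)
qed

lemma finite_measure_disc_area: "finite_measure disc_area"
proof
  show "emeasure disc_area (space disc_area) \<noteq> \<infinity>"
    using emeasure_lborel_ball_finite[of "0::complex" 1]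
    by (simp add: emeasure_disc_area ennreal_mult_eq_top_iff less_top)
qed

text \<open>The inverse is a second parameter and the axioms are symmetric in the two maps, so by
  \<open>swap\<close> every fact about \<open>\<phi>\<close> is also available for
  \<open>\<psi>\<close>.\<close>

locale disc_automorphism =
  fixes \<phi> \<psi> :: "complex \<Rightarrow> complex"
  assumes holomorphic: "\<phi> holomorphic_on ball 0 1" "\<psi> holomorphic_on ball 0 1"
    and maps: "z \<in> ball 0 1 \<Longrightarrow> \<phi> z \<in> ball 0 1" "z \<in> ball 0 1 \<Longrightarrow> \<psi> z \<in> ball 0 1"
    and inverse: "z \<in> ball 0 1 \<Longrightarrow> \<psi> (\<phi> z) = z" "z \<in> ball 0 1 \<Longrightarrow> \<phi> (\<psi> z) = z"

lemma (in disc_automorphism) swap: "disc_automorphism \<psi> \<phi>"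
  by unfold_locales (auto simp: holomorphic maps[simplified] inverse[simplified])

context disc_automorphism
begin

lemma DERIV_disc: "z \<in> ball 0 1 \<Longrightarrow> (\<phi> has_field_derivative deriv \<phi> z) (at z)"
  by (rule holomorphic_derivI[OF holomorphic(1) open_ball])

lemma measurable_self [measurable]: "\<phi> \<in> disc_area \<rightarrow>\<^sub>M disc_area"
proof -
  have "\<phi> \<in> borel_measurable disc_area"
    by (intro continuous_on_imp_borel_measurable_disc_area holomorphic_on_imp_continuous_on holomorphic)
  then have "\<phi> \<in> disc_area \<rightarrow>\<^sub>M restrict_space borel (ball 0 1)"
    using maps(1) by (intro measurable_restrict_space2) auto
  then show ?thesis
    using measurable_cong_sets[OF refl sets_disc_area] by blast
qed

lemma measurable_deriv [measurable]: "deriv \<phi> \<in> borel_measurable disc_area"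
  by (intro continuous_on_imp_borel_measurable_disc_area holomorphic_on_imp_continuous_on
      holomorphic_deriv holomorphic open_ball)

text \<open>Chain rule for \<open>\<phi> \<circ> \<psi>\<close>, which is the identity near every
  point of the open disc.\<close>

lemma deriv_inverse:
  assumes "z \<in> ball 0 1"
  shows "deriv \<psi> z * deriv \<phi> (\<psi> z) = 1"
proof -
  interpret inv: disc_automorphism \<psi> \<phi> by (rule swap)
  have "(\<phi> \<circ> \<psi> has_field_derivative deriv \<phi> (\<psi> z) * deriv \<psi> z) (at z)"
    using assms by (intro DERIV_chain DERIV_disc inv.DERIV_disc maps)
  moreover have "(\<phi> \<circ> \<psi> has_field_derivative 1) (at z)"
    using inverse(2) assms
    by (intro has_field_derivative_transform_within_open[OF DERIV_ident open_ball[of 0 1]]) auto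
  ultimately show ?thesis
    using DERIV_unique by (fastforce simp: mult.commute)
qed

lemma deriv_nonzero:
  assumes "z \<in> ball 0 1" shows "deriv \<phi> z \<noteq> 0"
  using deriv_inverse[OF maps(1)[OF assms]] inverse(1)[OF assms] by auto

text \<open>A measurable subset of the disc is the injective holomorphic image of its preimage, so
  its area is the integral of the squared modulus of the derivative over that preimage. The
  transformation rules for null sets and integrals both follow from this.\<close>

lemma distr_disc_area:
  "distr (density disc_area (\<lambda>z. ennreal ((cmod (deriv \<phi> z))\<^sup>2))) disc_area \<phi> = disc_area"
proof (rule measure_eqI)
  fix B assume "B \<in> sets (distr (density disc_area (\<lambda>z. ennreal ((cmod (deriv \<phi> z))\<^sup>2))) disc_area \<phi>)"
  then have Bd: "B \<in> sets disc_area" by simp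
  then have B: "B \<in> sets borel" "B \<subseteq> ball 0 1"
    by (auto simp: sets_disc_area sets_restrict_space_iff)
  define S where "S = \<phi> -` B \<inter> ball 0 1"
  have Sd: "S \<in> sets disc_area"
    using measurable_sets[OF measurable_self Bd] by (simp add: S_def)
  then have S: "S \<in> sets borel" "S \<subseteq> ball 0 1"
    by (auto simp: sets_disc_area sets_restrict_space_iff)
  have im: "\<phi> ` S = B"
    using B(2) maps(2) inverse(2) by (force simp: S_def image_iff)
  have meas: "(\<lambda>z. ennreal ((cmod (deriv \<phi> z))\<^sup>2)) \<in> borel_measurable disc_area"
    by measurable
  have "emeasure lborel B = (\<integral>\<^sup>+z\<in>S. ennreal ((cmod (deriv \<phi> z))\<^sup>2) \<partial>lborel)"
    unfolding im[symmetric]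
  proof (rule emeasure_holomorphic_image)
    show "\<phi> ` S \<in> sets borel" "bounded (\<phi> ` S)"
      using B bounded_subset[OF bounded_ball] by (auto simp: im)
    show "inj_on \<phi> S"
      by (rule inj_on_inverseI[of _ \<psi>]) (use S(2) inverse(1) in auto)
    show "deriv \<phi> \<in> borel_measurable (restrict_space borel S)"
      using measurable_deriv S(2) unfolding borel_measurable_disc_area_iff
      by (rule measurable_restrict_mono)
  qed (use S DERIV_disc in auto)
  also have "ennreal (1 / pi) * \<dots> =
      (\<integral>\<^sup>+z. ennreal ((cmod (deriv \<phi> z))\<^sup>2) * indicator S z \<partial>disc_area)"
    using meas Sd S(2)
    by (subst nn_integral_disc_area)
       (auto intro!: arg_cong[where f="\<lambda>x. ennreal (1 / pi) * x"] nn_integral_cong simp: indicator_def)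
  finally show "emeasure (distr (density disc_area (\<lambda>z. ennreal ((cmod (deriv \<phi> z))\<^sup>2))) disc_area \<phi>) B
      = emeasure disc_area B"
    using Bd Sd meas B by (simp add: emeasure_distr emeasure_density S_def emeasure_disc_area)
qed simp

text \<open>Pushing forward gives the claim almost everywhere for the weighted measure, and the
  weight vanishes nowhere on the disc. This is why composition with \<open>\<phi>\<close> respects
  almost-everywhere classes.\<close>

lemma AE_comp:
  assumes "AE z in disc_area. P z"
  shows "AE z in disc_area. P (\<phi> z)"
proof -
  let ?M = "density disc_area (\<lambda>z. ennreal ((cmod (deriv \<phi> z))\<^sup>2))"
  have "AE z in distr ?M disc_area \<phi>. P z"
    using assms by (simp only: distr_disc_area)
  then have "AE z in ?M. P (\<phi> z)"
    by (rule AE_distrD[rotated]) simp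
  then have "AE z in disc_area. 0 < ennreal ((cmod (deriv \<phi> z))\<^sup>2) \<longrightarrow> P (\<phi> z)"
    by (simp add: AE_density del: ennreal_less_zero_iff)
  moreover have "AE z in disc_area. z \<in> ball 0 1"
    by (rule AE_I2) simp
  ultimately show ?thesis
    by eventually_elim (auto simp: deriv_nonzero)
qed

text \<open>The general codomain covers both later uses: the real integrand of a squared norm and
  the complex integrand of \<open>cinner\<close>.\<close>

lemma change_of_variables:
  fixes f :: "complex \<Rightarrow> 'a::{banach, second_countable_topology}"
  assumes [measurable]: "f \<in> borel_measurable disc_area"
  shows "integrable disc_area (\<lambda>z. (cmod (deriv \<phi> z))\<^sup>2 *\<^sub>R f (\<phi> z)) \<longleftrightarrow> integrable disc_area f"
    and "(\<integral>z. (cmod (deriv \<phi> z))\<^sup>2 *\<^sub>R f (\<phi> z) \<partial>disc_area) = (\<integral>z. f z \<partial>disc_area)"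
proof -
  let ?M = "density disc_area (\<lambda>z. ennreal ((cmod (deriv \<phi> z))\<^sup>2))"
  have [measurable]: "\<phi> \<in> ?M \<rightarrow>\<^sub>M disc_area" by simp
  have "integrable (distr ?M disc_area \<phi>) f \<longleftrightarrow> integrable ?M (\<lambda>z. f (\<phi> z))"
    by (rule integrable_distr_eq) measurable
  then show "integrable disc_area (\<lambda>z. (cmod (deriv \<phi> z))\<^sup>2 *\<^sub>R f (\<phi> z)) \<longleftrightarrow> integrable disc_area f"
    by (simp only: distr_disc_area) (simp add: integrable_density)
  have "(\<integral>z. f z \<partial>distr ?M disc_area \<phi>) = (\<integral>z. f (\<phi> z) \<partial>?M)"
    by (rule integral_distr) measurable
  then show "(\<integral>z. (cmod (deriv \<phi> z))\<^sup>2 *\<^sub>R f (\<phi> z) \<partial>disc_area) = (\<integral>z. f z \<partial>disc_area)"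
    by (simp only: distr_disc_area) (simp add: integral_density)
qed

end

subsection \<open>Weighted composition operators\<close>

lemma sq_integrable_rep_l2: "sq_integrable (rep_l2 F)"
  using Quotient3_rep_reflp[OF Quotient3_l2_disc] by (simp add: l2_eq_def)

lemma to_l2_rep_l2 [simp]: "to_l2 (rep_l2 F) = F"
  by (rule Quotient3_abs_rep[OF Quotient3_l2_disc])

lemma l2_eq_rep_l2_to_l2: "sq_integrable f \<Longrightarrow> l2_eq (rep_l2 (to_l2 f)) f"
  by (rule rep_abs_rsp_left[OF Quotient3_l2_disc]) (simp add: l2_eq_def)

lemma to_l2_cong: "l2_eq f g \<Longrightarrow> to_l2 f = to_l2 g"
  by (rule Quotient3_rel_abs[OF Quotient3_l2_disc])

lemma l2_disc_cases: obtains f where "sq_integrable f" "F = to_l2 f"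
  using sq_integrable_rep_l2 to_l2_rep_l2 by metis

text \<open>The disc is the whole space of \<open>disc_area\<close>, so values elsewhere are
  invisible and \<open>g\<close> inherits square integrability from \<open>f\<close>.\<close>

lemma to_l2_cong_disc:
  assumes "sq_integrable f" "\<And>z. z \<in> ball 0 1 \<Longrightarrow> f z = g z"
  shows "to_l2 f = to_l2 g"
proof (rule to_l2_cong, rule l2_eqI)
  show "sq_integrable g"
    using assms measurable_cong[of disc_area f g borel]
      Bochner_Integration.integrable_cong[OF refl, of disc_area "\<lambda>z. (cmod (f z))\<^sup>2" "\<lambda>z. (cmod (g z))\<^sup>2"]
    by (simp add: sq_integrable_def)
  show "AE z in disc_area. f z = g z"
    by (rule AE_I2) (simp add: assms(2))
qed (rule assms)

lemma cinner_to_l2: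
  "sq_integrable f \<Longrightarrow> sq_integrable g \<Longrightarrow>
    cinner (to_l2 f) (to_l2 g) = (\<integral>z. f z * cnj (g z) \<partial>disc_area)"
  by (rule cinner.abs_eq) (simp_all add: l2_eq_def)

lemma scaleC_to_l2: "sq_integrable f \<Longrightarrow> c *\<^sub>C to_l2 f = to_l2 (\<lambda>z. c * f z)"
  by (rule scaleC.abs_eq) (simp add: l2_eq_def)

lemma plus_to_l2:
  "sq_integrable f \<Longrightarrow> sq_integrable g \<Longrightarrow> to_l2 f + to_l2 g = to_l2 (\<lambda>z. f z + g z)"
  by (rule plus_l2_disc.abs_eq) (simp_all add: l2_eq_def)

lemma minus_to_l2:
  "sq_integrable f \<Longrightarrow> sq_integrable g \<Longrightarrow> to_l2 f - to_l2 g = to_l2 (\<lambda>z. f z - g z)"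
  by (rule minus_l2_disc.abs_eq) (simp_all add: l2_eq_def)

lemma cinner_diff_left: "cinner (F - G) H = cinner F H - cinner G H"
  by transfer (simp add: l2_eq_def left_diff_distrib integrable_mult_cnj)

lemma cinner_diff_right: "cinner H (F - G) = cinner H F - cinner H G"
  by transfer (simp add: l2_eq_def right_diff_distrib integrable_mult_cnj)

lemma cinner_scaleC_left: "cinner (c *\<^sub>C F) G = c * cinner F G"
  by transfer (simp add: mult.assoc)

lemma cinner_scaleC_right: "cinner F (c *\<^sub>C G) = cnj c * cinner F G"
proof transfer
  fix F G :: "complex \<Rightarrow> complex" and c
  have "F z * cnj (c * G z) = cnj c * (F z * cnj (G z))" for z
    by simp
  then show "(\<integral>z. F z * cnj (c * G z) \<partial>disc_area) = cnj c * (\<integral>z. F z * cnj (G z) \<partial>disc_area)"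
    by (simp only: integral_mult_right_zero)
qed

text \<open>The real part of \<open>cinner\<close> is already a nondegenerate inner product. This
  provides the uniqueness of adjoints.\<close>

lemma cinner_eqI:
  assumes "\<And>F. cinner F A = cinner F B" shows "A = B"
proof -
  have "\<forall>F. inner F A = inner F B"
    by (simp add: inner_l2_disc_def assms)
  then show ?thesis by (simp only: vector_eq_ldot)
qed

text \<open>A common form for \<open>U_op \<phi>\<close>, with weight \<open>deriv \<phi>\<close>,
  and \<open>Ubar_op \<phi>\<close>, with the conjugate weight.\<close>

definition weighted_comp :: "(complex \<Rightarrow> complex) \<Rightarrow> (complex \<Rightarrow> complex) \<Rightarrow> l2_disc \<Rightarrow> l2_disc" where
  "weighted_comp u \<phi> F = to_l2 (\<lambda>z. u z * rep_l2 F (\<phi> z))"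

text \<open>Only the modulus of the weight is prescribed: inner products see the weight through
  \<open>u z * cnj (u z)\<close>, which does not distinguish \<open>deriv \<phi>\<close> from its
  conjugate.\<close>

locale weighted_disc_automorphism = disc_automorphism +
  fixes u :: "complex \<Rightarrow> complex"
  assumes weight_measurable [measurable]: "u \<in> borel_measurable disc_area"
    and cmod_weight: "z \<in> ball 0 1 \<Longrightarrow> cmod (u z) = cmod (deriv \<phi> z)"
begin

lemma sq_integrable_weighted:
  assumes "sq_integrable f"
  shows "sq_integrable (\<lambda>z. u z * f (\<phi> z))"
proof -
  have [measurable]: "f \<in> borel_measurable disc_area"
    using assms by (simp add: sq_integrable_def)
  have "integrable disc_area (\<lambda>z. (cmod (deriv \<phi> z))\<^sup>2 *\<^sub>R (cmod (f (\<phi> z)))\<^sup>2)"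
    using assms by (subst change_of_variables(1)) (simp_all add: sq_integrable_def)
  also have "?this \<longleftrightarrow> integrable disc_area (\<lambda>z. (cmod (u z * f (\<phi> z)))\<^sup>2)"
    by (rule Bochner_Integration.integrable_cong)
      (simp_all add: norm_mult cmod_weight power_mult_distrib)
  finally show ?thesis
    by (simp add: sq_integrable_def)
qed

text \<open>The representative chosen by \<open>rep_l2\<close> differs from \<open>f\<close> on a
  null set only, and \<open>AE_comp\<close> preserves this under composition. Later computations can
  thus use any convenient representative.\<close>

lemma weighted_comp_to_l2:
  assumes "sq_integrable f"
  shows "weighted_comp u \<phi> (to_l2 f) = to_l2 (\<lambda>z. u z * f (\<phi> z))"
  unfolding weighted_comp_def
proof (rule to_l2_cong, rule l2_eqI)
  show "AE z in disc_area. u z * rep_l2 (to_l2 f) (\<phi> z) = u z * f (\<phi> z)"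
    using AE_comp[OF l2_eqD(3)[OF l2_eq_rep_l2_to_l2[OF assms]]] by eventually_elim simp
qed (intro sq_integrable_weighted sq_integrable_rep_l2 assms)+

text \<open>The two weights multiply to the Jacobian \<open>(cmod (deriv \<phi> z))\<^sup>2\<close>,
  so this is the change of variables for the integrand of \<open>cinner F G\<close>.\<close>

lemma cinner_weighted_comp: "cinner (weighted_comp u \<phi> F) (weighted_comp u \<phi> G) = cinner F G"
proof -
  obtain f where f: "sq_integrable f" "F = to_l2 f" by (rule l2_disc_cases)
  obtain g where g: "sq_integrable g" "G = to_l2 g" by (rule l2_disc_cases)
  have "cinner (weighted_comp u \<phi> F) (weighted_comp u \<phi> G)
      = (\<integral>z. u z * f (\<phi> z) * cnj (u z * g (\<phi> z)) \<partial>disc_area)"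
    using f g by (simp add: weighted_comp_to_l2 cinner_to_l2 sq_integrable_weighted)
  also have "\<dots> = (\<integral>z. (cmod (deriv \<phi> z))\<^sup>2 *\<^sub>R (f (\<phi> z) * cnj (g (\<phi> z))) \<partial>disc_area)"
  proof (rule Bochner_Integration.integral_cong)
    fix z assume "z \<in> space disc_area"
    then have "u z * cnj (u z) = of_real ((cmod (deriv \<phi> z))\<^sup>2)"
      by (simp add: complex_norm_square[symmetric] cmod_weight)
    then show "u z * f (\<phi> z) * cnj (u z * g (\<phi> z))
        = (cmod (deriv \<phi> z))\<^sup>2 *\<^sub>R (f (\<phi> z) * cnj (g (\<phi> z)))"
      unfolding scaleR_conv_of_real by (metis complex_cnj_mult mult.assoc mult.left_commute)
  qed simp
  also have "\<dots> = cinner F G"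
    using f g by (simp add: change_of_variables(2)[OF measurable_mult_cnj] cinner_to_l2)
  finally show ?thesis .
qed

lemma norm_weighted_comp: "norm (weighted_comp u \<phi> F) = norm F"
  by (simp add: norm_l2_disc_def inner_l2_disc_def cinner_weighted_comp)

lemma weighted_comp_scaleC: "weighted_comp u \<phi> (c *\<^sub>C F) = c *\<^sub>C weighted_comp u \<phi> F"
proof -
  obtain f where f: "sq_integrable f" "F = to_l2 f" by (rule l2_disc_cases)
  then show ?thesis
    by (simp add: scaleC_to_l2 weighted_comp_to_l2 sq_integrable_cmult sq_integrable_weighted
        mult.left_commute)
qed

lemma weighted_comp_add:
  "weighted_comp u \<phi> (F + G) = weighted_comp u \<phi> F + weighted_comp u \<phi> G"
proof -
  obtain f where f: "sq_integrable f" "F = to_l2 f" by (rule l2_disc_cases)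
  obtain g where g: "sq_integrable g" "G = to_l2 g" by (rule l2_disc_cases)
  show ?thesis
    using f g by (simp add: plus_to_l2 weighted_comp_to_l2 sq_integrable_add sq_integrable_weighted
        distrib_left)
qed

lemma bounded_op_weighted_comp: "bounded_op (weighted_comp u \<phi>)"
  unfolding bounded_op_def
proof (intro conjI allI weighted_comp_scaleC)
  show "bounded_linear (weighted_comp u \<phi>)"
    by (rule bounded_linear_intro[of _ 1])
      (simp_all add: weighted_comp_add weighted_comp_scaleC scaleR_l2_disc_def norm_weighted_comp)
qed

end

text \<open>The relation between the weights is the one that the chain rule gives for the
  derivatives of \<open>\<phi>\<close> and \<open>\<psi>\<close>, or for their conjugates; it makes
  the two weighted compositions mutually inverse.\<close>

locale weighted_disc_automorphism_pair =
  weighted_disc_automorphism \<phi> \<psi> u + inv: weighted_disc_automorphism \<psi> \<phi> v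
  for \<phi> \<psi> u v +
  assumes weights: "z \<in> ball 0 1 \<Longrightarrow> u z * v (\<phi> z) = 1"
begin

lemma swap_pair: "weighted_disc_automorphism_pair \<psi> \<phi> v u"
proof
  fix z :: complex assume z: "z \<in> ball 0 1"
  show "v z * u (\<psi> z) = 1"
    using weights[OF maps(2)[OF z]] inverse(2)[OF z] by (simp add: mult.commute)
qed

lemma weighted_comp_inverse: "weighted_comp u \<phi> (weighted_comp v \<psi> F) = F"
proof -
  obtain f where f: "sq_integrable f" "F = to_l2 f" by (rule l2_disc_cases)
  have "weighted_comp u \<phi> (weighted_comp v \<psi> F) = to_l2 (\<lambda>z. u z * (v (\<phi> z) * f (\<psi> (\<phi> z))))"
    using f by (simp add: inv.weighted_comp_to_l2 weighted_comp_to_l2 inv.sq_integrable_weighted)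
  also have "\<dots> = to_l2 f"
    using f weights inverse(1)
    by (intro to_l2_cong_disc sq_integrable_weighted inv.sq_integrable_weighted)
      (auto simp flip: mult.assoc)
  finally show ?thesis using f by simp
qed

lemma cinner_weighted_comp_left:
  "cinner (weighted_comp u \<phi> F) G = cinner F (weighted_comp v \<psi> G)"
  using cinner_weighted_comp[of F "weighted_comp v \<psi> G"] by (simp add: weighted_comp_inverse)

text \<open>An isometry with a right inverse has that inverse as its adjoint. Since
  \<open>op_adjoint\<close> is a definite description, uniqueness is needed too and comes from
  \<open>cinner_eqI\<close>.\<close>

lemma op_adjoint_weighted_comp: "op_adjoint (weighted_comp u \<phi>) = weighted_comp v \<psi>"
  unfolding op_adjoint_def
proof (rule the_equality)
  fix S assume "\<forall>F G. cinner (weighted_comp u \<phi> F) G = cinner F (S G)"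
  then show "S = weighted_comp v \<psi>"
    by (intro ext cinner_eqI) (simp add: cinner_weighted_comp_left)
qed (simp add: cinner_weighted_comp_left)

end

section \<open>Boundedness and norm of products of operators\<close>

lemma bounded_op_comp: "bounded_op S \<Longrightarrow> bounded_op T \<Longrightarrow> bounded_op (S \<circ> T)"
  by (auto simp: bounded_op_def o_def intro: bounded_linear_compose)

text \<open>\<open>onorm\<close> is a supremum of quotients of norms: \<open>U\<close> drops out of
  the numerators, and \<open>V\<close> merely relabels the vectors, reaching all of them by
  surjectivity.\<close>

lemma onorm_isometries:
  assumes "\<And>x. norm (U x) = norm x" "\<And>x. norm (V x) = norm x" "surj V"
  shows "onorm (\<lambda>x. U (T (V x))) = onorm T"
proof -
  have "range (\<lambda>x. norm (U (T (V x))) / norm x) = (\<lambda>y. norm (T y) / norm y) ` range V"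
    using assms(1,2) by (simp add: image_image)
  then show ?thesis
    using assms(3) by (simp add: onorm_def)
qed

subsection \<open>Szego kernels and Moebius automorphisms\<close>

lemma one_minus_mult_nonzero:
  fixes a b :: complex
  assumes "cmod a < 1" "cmod b \<le> 1"
  shows "1 - a * b \<noteq> 0"
proof
  assume "1 - a * b = 0"
  then have "cmod a * cmod b = 1"
    by (metis eq_iff_diff_eq_0 norm_mult norm_one)
  moreover have "cmod a * cmod b \<le> cmod a"
    using assms by (simp add: mult_left_le)
  ultimately show False
    using assms by simp
qed

text \<open>Continuity up to the boundary gives boundedness by compactness, and the disc has finite
  area. The Szego kernels qualify because their denominators do not vanish even on the unit
  circle.\<close>

lemma sq_integrable_continuous_on_cball:
  assumes "continuous_on (cball 0 1) f"
  shows "sq_integrable f"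
proof -
  interpret finite_measure disc_area by (rule finite_measure_disc_area)
  have [measurable]: "f \<in> borel_measurable disc_area"
    by (rule continuous_on_imp_borel_measurable_disc_area)
      (rule continuous_on_subset[OF assms ball_subset_cball])
  have "bounded (f ` cball 0 1)"
    by (intro compact_imp_bounded compact_continuous_image assms compact_cball)
  then obtain B where B: "\<And>z. z \<in> cball 0 1 \<Longrightarrow> cmod (f z) \<le> B"
    unfolding bounded_iff by (metis imageI)
  have "integrable disc_area (\<lambda>z. (cmod (f z))\<^sup>2)"
    using B by (intro integrable_const_bound[of _ "B\<^sup>2"] AE_I2) (auto intro: power_mono)
  then show ?thesis
    by (simp add: sq_integrable_def)
qed

lemma sq_integrable_szego:
  assumes "cmod z < 1"
  shows "sq_integrable (szego z)" "sq_integrable (\<lambda>\<zeta>. cnj (szego z \<zeta>))"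
proof -
  have nz: "\<forall>\<zeta>\<in>cball 0 1. 1 - cnj z * \<zeta> \<noteq> 0"
    using assms one_minus_mult_nonzero[of "cnj z"] by (simp del: right_minus_eq)
  show "sq_integrable (szego z)" "sq_integrable (\<lambda>\<zeta>. cnj (szego z \<zeta>))"
    unfolding szego_def by (intro sq_integrable_continuous_on_cball continuous_intros nz)+
qed

text \<open>The map is a Moebius function without rotation followed by a rotation through
  \<open>t\<close>. The inverse therefore rotates back first and then applies the Moebius function
  with parameter \<open>- a\<close>.\<close>

lemma disc_automorphism_Moebius:
  assumes a: "cmod a < 1" and \<phi>: "\<And>z. z \<in> ball 0 1 \<Longrightarrow> \<phi> z = Moebius_function t a z"
  shows "disc_automorphism \<phi> (\<lambda>z. Moebius_function 0 (- a) (exp (- \<i> * of_real t) * z))"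
proof
  define e where "e = exp (\<i> * of_real t)"
  have e: "exp (- \<i> * of_real t) = inverse e" "e \<noteq> 0" "cmod e = 1"
    by (simp_all add: e_def exp_minus)
  have Moebius: "Moebius_function t a z = e * Moebius_function 0 a z" for z
    by (simp add: Moebius_function_def e_def)
  have rot: "cmod (inverse e * z) = cmod z" for z
    using e by (simp add: norm_mult norm_inverse)
  show "\<phi> holomorphic_on ball 0 1"
    by (rule holomorphic_transform[OF Moebius_function_holomorphic[OF a, of t]]) (simp add: \<phi>)
  have "Moebius_function 0 (- a) \<circ> (\<lambda>z. inverse e * z) holomorphic_on ball 0 1"
    by (rule holomorphic_on_compose_gen[of _ _ _ "ball 0 1"])
      (use a rot in \<open>auto intro!: holomorphic_intros Moebius_function_holomorphic\<close>)
  then show "(\<lambda>z. Moebius_function 0 (- a) (exp (- \<i> * of_real t) * z)) holomorphic_on ball 0 1"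
    by (simp only: e o_def)
  fix z :: complex assume "z \<in> ball 0 1"
  then have z: "cmod z < 1" by simp
  show \<phi>z: "\<phi> z \<in> ball 0 1"
    using a z Moebius_function_norm_lt_1 \<phi> by simp
  show \<psi>z: "Moebius_function 0 (- a) (exp (- \<i> * of_real t) * z) \<in> ball 0 1"
    unfolding e mem_ball_0 using a z rot by (intro Moebius_function_norm_lt_1) auto
  show "Moebius_function 0 (- a) (exp (- \<i> * of_real t) * \<phi> z) = z"
    using a z e(2) unfolding e(1) by (simp add: \<phi> Moebius Moebius_function_compose flip: mult.assoc)
  show "\<phi> (Moebius_function 0 (- a) (exp (- \<i> * of_real t) * z)) = z"
    using a z e(2) \<psi>z rot[of z] unfolding e(1)
    by (simp add: \<phi> Moebius Moebius_function_compose flip: mult.assoc)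
qed

text \<open>The left side is minus the logarithmic derivative of
  \<open>1 - cnj w * \<psi> \<zeta>\<close> in \<open>\<zeta>\<close>. The computation writes it as
  one fraction and splits that fraction into two kernels.\<close>

lemma szego_deriv_Moebius_inverse:
  assumes a: "cmod a < 1" and \<phi>: "\<And>z. z \<in> ball 0 1 \<Longrightarrow> \<phi> z = Moebius_function t a z"
    and \<psi>: "\<psi> = (\<lambda>z. Moebius_function 0 (- a) (exp (- \<i> * of_real t) * z))"
    and w: "cmod w < 1" and \<zeta>: "cmod \<zeta> < 1"
  shows "cnj w * (deriv \<psi> \<zeta> * szego w (\<psi> \<zeta>)) =
    cnj (\<phi> w) * szego (\<phi> w) \<zeta> - cnj (\<phi> 0) * szego (\<phi> 0) \<zeta>"
proof -
  interpret disc_automorphism \<phi> \<psi>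
    unfolding \<psi> by (rule disc_automorphism_Moebius[OF a \<phi>])
  define E where "E = exp (- \<i> * of_real t)"
  have E: "cnj (exp (\<i> * of_real t)) = E" "cmod E = 1"
    by (simp_all add: E_def exp_cnj)
  have \<psi>_eq: "\<psi> x = (E * x + a) / (1 + cnj a * E * x)" for x
    by (simp add: \<psi> Moebius_function_def E_def mult.assoc)
  have q: "1 + cnj a * E * \<zeta> \<noteq> 0"
    using one_minus_mult_nonzero[of "- cnj a" "E * \<zeta>"] a \<zeta> E by (simp add: norm_mult mult.assoc)
  have aw: "1 - a * cnj w \<noteq> 0"
    using one_minus_mult_nonzero[of a "cnj w"] a w by simp
  have \<phi>w: "cnj (\<phi> w) = E * (cnj w - cnj a) / (1 - a * cnj w)"
    using w by (simp add: \<phi> Moebius_function_def E)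
  have \<phi>0: "cnj (\<phi> 0) = - E * cnj a"
    by (simp add: \<phi> Moebius_function_def E)
  have "cmod (\<phi> w) < 1" "cmod (\<psi> \<zeta>) < 1"
    using maps(1)[of w] maps(2)[of \<zeta>] w \<zeta> by auto
  then have nz: "1 - cnj (\<phi> w) * \<zeta> \<noteq> 0" "1 - cnj w * \<psi> \<zeta> \<noteq> 0"
    using one_minus_mult_nonzero[of "cnj (\<phi> w)" \<zeta>] one_minus_mult_nonzero[of "cnj w" "\<psi> \<zeta>"] w \<zeta>
    by auto
  \<comment> \<open>\<open>r\<close> is affine in \<open>\<zeta>\<close> and is the common numerator
    of \<open>1 - cnj (\<phi> w) * \<zeta>\<close> and
    \<open>1 - cnj w * \<psi> \<zeta>\<close>.\<close>
  define r where "r = 1 - a * cnj w - E * (cnj w - cnj a) * \<zeta>"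
  have r: "1 - cnj (\<phi> w) * \<zeta> = r / (1 - a * cnj w)"
    using aw by (simp add: \<phi>w r_def field_simps)
  have r': "1 - cnj w * \<psi> \<zeta> = r / (1 + cnj a * E * \<zeta>)"
    using q by (simp add: \<psi>_eq r_def field_simps)
  have r0: "r \<noteq> 0"
    using nz(1) r by auto
  have "deriv \<psi> \<zeta> = E * (1 - a * cnj a) / (1 + cnj a * E * \<zeta>)\<^sup>2"
    unfolding \<psi>_eq[abs_def] using q
    by (intro DERIV_imp_deriv) (auto intro!: derivative_eq_intros simp: field_simps power2_eq_square)
  then have "cnj w * (deriv \<psi> \<zeta> * szego w (\<psi> \<zeta>))
      = cnj w * E * (1 - a * cnj a) / ((1 + cnj a * E * \<zeta>) * r)"
    using q r0 by (simp add: szego_def r' power2_eq_square)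
  \<comment> \<open>Partial fractions in \<open>\<zeta>\<close>: up to a constant \<open>r\<close>
    is the denominator of the kernel at \<open>\<phi> w\<close>, and the other factor is the
    denominator of the kernel at \<open>\<phi> 0\<close>.\<close>
  also have "\<dots> = E * (cnj w - cnj a) / r + E * cnj a / (1 + cnj a * E * \<zeta>)"
    using q r0 by (simp add: divide_simps) (simp add: r_def algebra_simps)
  also have "E * (cnj w - cnj a) / r = cnj (\<phi> w) * szego (\<phi> w) \<zeta>"
    unfolding szego_def r using aw by (simp add: \<phi>w)
  also have "E * cnj a / (1 + cnj a * E * \<zeta>) = - (cnj (\<phi> 0) * szego (\<phi> 0) \<zeta>)"
    by (simp add: szego_def \<phi>0 mult_ac)
  finally show ?thesis by simp
qed

section \<open>Norm and symbol of the transported operator\<close>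

theorem theorem1p10p3:
  fixes \<phi> :: "complex \<Rightarrow> complex" and T :: "l2_disc \<Rightarrow> l2_disc"
  assumes "moebius_automorphism \<phi>" and "bounded_op T"
  shows "bounded_op (transported_op \<phi> T) \<and>
         onorm (transported_op \<phi> T) = onorm T \<and>
         (\<forall>z\<in>ball 0 1.
           Q_diag (transported_op \<phi> T) z =
             Q_diag T (\<phi> z) - Q_symbol T (\<phi> z) (\<phi> 0) - Q_symbol T (\<phi> 0) (\<phi> z)
               + Q_diag T (\<phi> 0))"
proof -
  obtain t a where a: "cmod a < 1" and \<phi>: "\<And>z. z \<in> ball 0 1 \<Longrightarrow> \<phi> z = Moebius_function t a z"
    using assms(1) by (auto simp: moebius_automorphism_def)
  define \<psi> where "\<psi> = (\<lambda>z. Moebius_function 0 (- a) (exp (- \<i> * of_real t) * z))"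
  interpret disc_automorphism \<phi> \<psi>
    unfolding \<psi>_def by (rule disc_automorphism_Moebius[OF a \<phi>])
  interpret inv: disc_automorphism \<psi> \<phi> by (rule swap)
  have [measurable]: "cnj \<in> borel_measurable borel"
    by (intro borel_measurable_continuous_onI continuous_intros)
  have weights: "deriv \<phi> z * deriv \<psi> (\<phi> z) = 1" if "z \<in> ball 0 1" for z
    using inv.deriv_inverse[OF that] by simp
  then have weights': "cnj (deriv \<phi> z) * cnj (deriv \<psi> (\<phi> z)) = 1" if "z \<in> ball 0 1" for z
    using that by (metis complex_cnj_mult complex_cnj_one)
  interpret U: weighted_disc_automorphism_pair \<phi> \<psi> "deriv \<phi>" "deriv \<psi>"
    by unfold_locales (simp_all add: weights[simplified])
  interpret Ubar: weighted_disc_automorphism_pair \<phi> \<psi> "\<lambda>z. cnj (deriv \<phi> z)" "\<lambda>z. cnj (deriv \<psi> z)"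
    by unfold_locales (simp_all add: weights'[simplified])
  interpret V: weighted_disc_automorphism_pair \<psi> \<phi> "\<lambda>z. cnj (deriv \<psi> z)" "\<lambda>z. cnj (deriv \<phi> z)"
    by (rule Ubar.swap_pair)
  let ?U = "weighted_comp (deriv \<phi>) \<phi>" and ?U' = "weighted_comp (deriv \<psi>) \<psi>"
    and ?V = "weighted_comp (\<lambda>z. cnj (deriv \<psi> z)) \<psi>"
  have "Ubar_op \<phi> = weighted_comp (\<lambda>z. cnj (deriv \<phi> z)) \<phi>" "U_op \<phi> = ?U"
    by (simp_all add: fun_eq_iff Ubar_op_def U_op_def weighted_comp_def)
  then have transported: "transported_op \<phi> T = ?U \<circ> T \<circ> ?V"
    by (simp add: transported_op_def Ubar.op_adjoint_weighted_comp)
  \<comment> \<open>The composition with \<open>\<phi>\<close> and the conjugate weight is a right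
    inverse of \<open>?V\<close>.\<close>
  have "surj ?V"
    by (metis V.weighted_comp_inverse surjI)
  then have "onorm (transported_op \<phi> T) = onorm T"
    using onorm_isometries[OF U.norm_weighted_comp Ubar.inv.norm_weighted_comp]
    by (simp add: transported o_def)
  moreover have "bounded_op (transported_op \<phi> T)"
    unfolding transported using assms(2)
    by (intro bounded_op_comp U.bounded_op_weighted_comp Ubar.inv.bounded_op_weighted_comp)
  moreover have "Q_diag (transported_op \<phi> T) z =
      Q_diag T (\<phi> z) - Q_symbol T (\<phi> z) (\<phi> 0) - Q_symbol T (\<phi> 0) (\<phi> z) + Q_diag T (\<phi> 0)"
    if "z \<in> ball 0 1" for z
  proof -
    have z: "cmod z < 1" using that by simp
    define s where "s = (\<lambda>w. to_l2 (szego w))"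
    define sb where "sb = (\<lambda>w. to_l2 (\<lambda>\<zeta>. cnj (szego w \<zeta>)))"
    have \<phi>z: "cmod (\<phi> z) < 1" and \<phi>0: "cmod (\<phi> 0) < 1"
      using maps(1)[of z] maps(1)[of 0] z by auto
    note kernel = szego_deriv_Moebius_inverse[OF a \<phi> \<psi>_def z]
    note sq = sq_integrable_szego sq_integrable_cmult sq_integrable_diff
    have s: "cnj z *\<^sub>C ?U' (s z) = cnj (\<phi> z) *\<^sub>C s (\<phi> z) - cnj (\<phi> 0) *\<^sub>C s (\<phi> 0)"
    proof -
      have "cnj z *\<^sub>C ?U' (s z) = to_l2 (\<lambda>\<zeta>. cnj z * (deriv \<psi> \<zeta> * szego z (\<psi> \<zeta>)))"
        using z by (simp add: s_def U.inv.weighted_comp_to_l2 scaleC_to_l2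
            U.inv.sq_integrable_weighted sq_integrable_szego)
      also have "\<dots> = to_l2 (\<lambda>\<zeta>. cnj (\<phi> z) * szego (\<phi> z) \<zeta> - cnj (\<phi> 0) * szego (\<phi> 0) \<zeta>)"
        using z kernel by (intro to_l2_cong_disc sq U.inv.sq_integrable_weighted) auto
      also have "\<dots> = cnj (\<phi> z) *\<^sub>C s (\<phi> z) - cnj (\<phi> 0) *\<^sub>C s (\<phi> 0)"
        using \<phi>z \<phi>0 by (simp add: s_def scaleC_to_l2 minus_to_l2 sq)
      finally show ?thesis .
    qed
    have sb: "z *\<^sub>C ?V (sb z) = \<phi> z *\<^sub>C sb (\<phi> z) - \<phi> 0 *\<^sub>C sb (\<phi> 0)"
    proof -
      \<comment> \<open>Conjugating the kernel identity gives its analogue for the first slot, where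
        both the weight and the kernel are conjugated.\<close>
      have kernel': "z * (cnj (deriv \<psi> \<zeta>) * cnj (szego z (\<psi> \<zeta>))) =
          \<phi> z * cnj (szego (\<phi> z) \<zeta>) - \<phi> 0 * cnj (szego (\<phi> 0) \<zeta>)" if "cmod \<zeta> < 1" for \<zeta>
        using arg_cong[OF kernel[OF _ that], of cnj] by simp
      have "z *\<^sub>C ?V (sb z) = to_l2 (\<lambda>\<zeta>. z * (cnj (deriv \<psi> \<zeta>) * cnj (szego z (\<psi> \<zeta>))))"
        using z Ubar.inv.sq_integrable_weighted[OF sq_integrable_szego(2)[OF z]]
        by (simp add: sb_def Ubar.inv.weighted_comp_to_l2 scaleC_to_l2 sq_integrable_szego)
      also have "\<dots> = to_l2 (\<lambda>\<zeta>. \<phi> z * cnj (szego (\<phi> z) \<zeta>) - \<phi> 0 * cnj (szego (\<phi> 0) \<zeta>))"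
        by (rule to_l2_cong_disc, rule sq_integrable_cmult,
            rule Ubar.inv.sq_integrable_weighted[OF sq_integrable_szego(2)[OF z]])
          (simp add: kernel')
      also have "\<dots> = \<phi> z *\<^sub>C sb (\<phi> z) - \<phi> 0 *\<^sub>C sb (\<phi> 0)"
        using \<phi>z \<phi>0 by (simp add: sb_def scaleC_to_l2 minus_to_l2 sq)
      finally show ?thesis .
    qed
    have T: "T (c *\<^sub>C F) = c *\<^sub>C T F" "T (F - G) = T F - T G" for c F G
      using assms(2) linear_diff[of T F G] by (simp_all add: bounded_op_def bounded_linear.linear)
    \<comment> \<open>The outer unitary moves to the second slot as \<open>?U'\<close>. Then each
      slot absorbs one factor of the square; the second is conjugate linear, so the factor enters
      there as \<open>cnj z\<close>, matching the left sides of \<open>sb\<close> and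
      \<open>s\<close>.\<close>
    have "Q_diag (transported_op \<phi> T) z = z * (z * cinner (T (?V (sb z))) (?U' (s z)))"
      by (simp add: Q_diag_def dirichlet_symbol_def transported s_def sb_def power2_eq_square
          U.cinner_weighted_comp_left)
    also have "\<dots> = cinner (T (z *\<^sub>C ?V (sb z))) (cnj z *\<^sub>C ?U' (s z))"
      by (simp add: T cinner_scaleC_left cinner_scaleC_right)
    \<comment> \<open>Each slot is now a difference of kernels at \<open>\<phi> z\<close> and
      \<open>\<phi> 0\<close>: the equal points give the diagonal terms, the mixed ones the two
      terms with a minus sign.\<close>
    also have "\<dots> = Q_diag T (\<phi> z) - Q_symbol T (\<phi> z) (\<phi> 0) - Q_symbol T (\<phi> 0) (\<phi> z)
        + Q_diag T (\<phi> 0)"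
      unfolding s sb
      by (simp add: T cinner_diff_left cinner_diff_right cinner_scaleC_left cinner_scaleC_right
          Q_diag_def Q_symbol_def dirichlet_symbol_def s_def sb_def power2_eq_square algebra_simps)
    finally show ?thesis .
  qed
  ultimately show ?thesis by blast
qed

end
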